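(* Let $\Gamma$ be a simple strongly connected digraph with vertex set $X$ and diameter $D$. Then $\Gamma$ is a distance-regular digraph if and only if, for all $x,y\in X$ with $y\in\Gamma^{\rightarrow}_h(x)$ $(0\le h\le D)$, the numbers $s^h_{i1}:=|\Gamma^{\rightarrow}_i(x)\cap\Gamma^{\rightarrow}_1(y)|$ $(0\le i\le D)$ do not depend on the choice of $x$ and $y$ but only on $h$ (and $i$).
   Context: $\partial(x,y)$ is the directed distance; $\Gamma^{\rightarrow}_i(x)=\{z\mid\partial(x,z)=i\}$, $\Gamma^{\leftarrow}_i(x)=\{z\mid\partial(z,x)=i\}$. $\Gamma$ is a distance-regular digraph if there are integers $d^{\rightarrow}_{ij},d^{\leftarrow}_{ij}$ $(0\le i,j\le D)$ such that for every $x\in X$ and every $y\in\Gamma^{\rightarrow}_i(x)$: $|\Gamma^{\rightarrow}_1(y)\cap\Gamma^{\rightarrow}_j(x)|=d^{\rightarrow}_{ij}$ and $|\Gamma^{\leftarrow}_1(y)\cap\Gamma^{\rightarrow}_j(x)|=d^{\leftarrow}_{ij}$. *)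

theory Defs
  imports "Graph_Theory.Graph_Theory"
begin

text \<open>
  The distance counts arcs, so it is the weighted distance for the constant weight 1. It is
  \<open>\<infinity>\<close> if no directed walk leads from \<open>x\<close> to \<open>y\<close>.
\<close>

definition ddist :: "('a, 'b) pre_digraph \<Rightarrow> 'a \<Rightarrow> 'a \<Rightarrow> ereal" where
  "ddist G x y = wf_digraph.\<mu> G (\<lambda>_. 1) x y"

definition diam :: "('a, 'b) pre_digraph \<Rightarrow> ereal" where
  "diam G = (SUP x \<in> verts G. SUP y \<in> verts G. ddist G x y)"

definition out_sphere :: "('a, 'b) pre_digraph \<Rightarrow> nat \<Rightarrow> 'a \<Rightarrow> 'a set" where
  "out_sphere G i x = {z \<in> verts G. ddist G x z = ereal (real i)}"

definition in_sphere :: "('a, 'b) pre_digraph \<Rightarrow> nat \<Rightarrow> 'a \<Rightarrow> 'a set" where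
  "in_sphere G i x = {z \<in> verts G. ddist G z x = ereal (real i)}"

definition distance_regular_digraph :: "('a, 'b) pre_digraph \<Rightarrow> bool" where
  "distance_regular_digraph G \<longleftrightarrow>
    (\<exists>d_out d_in :: nat \<Rightarrow> nat \<Rightarrow> int.
      \<forall>i j. ereal (real i) \<le> diam G \<longrightarrow> ereal (real j) \<le> diam G \<longrightarrow>
        (\<forall>x \<in> verts G. \<forall>y \<in> out_sphere G i x.
          int (card (out_sphere G 1 y \<inter> out_sphere G j x)) = d_out i j \<and>
          int (card (in_sphere G 1 y \<inter> out_sphere G j x)) = d_in i j))"

end

theory Submission
  imports Defs
begin

text \<open>
  Let \<open>A\<^sub>k\<close> be the distance-\<open>k\<close> matrix and \<open>V\<close> the span of all \<open>A\<^sub>k\<close>, that is, the matrices whose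
  \<open>(x,y)\<close> entry depends only on the distance from \<open>x\<close> to \<open>y\<close>. The condition of the theorem says
  that \<open>V\<close> is closed under right multiplication by \<open>A\<^sub>1\<^sup>T\<close>.
  By induction on \<open>k\<close>, whether one can return from \<open>y\<close> to \<open>x\<close> in at most \<open>k\<close> steps depends
  only on the distance from \<open>x\<close> to \<open>y\<close>; so that distance determines the distance back, and \<open>V\<close>
  is closed under transposition. Hence \<open>A\<^sub>k\<^sup>T A\<^sub>1\<^sup>T\<close> is a combination of \<open>A\<^sub>0\<^sup>T, \<dots>, A\<^sub>k\<^sub>+\<^sub>1\<^sup>T\<close> with a
  positive coefficient at \<open>A\<^sub>k\<^sub>+\<^sub>1\<^sup>T\<close>, so by induction \<open>V\<close> is closed under right multiplication by
  every \<open>A\<^sub>k\<^sup>T\<close>. As \<open>A\<^sub>1\<close> is one of these, \<open>V A\<^sub>1 \<subseteq> V\<close>, which is the missing half of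
  distance-regularity.
\<close>

section \<open>Natural-number distances, with adjacency read as distance 1\<close>

locale digraph_metric =
  fixes X :: "'a set" and d :: "'a \<Rightarrow> 'a \<Rightarrow> nat"
  assumes finite_X: "finite X"
    and d_eq_0_iff: "\<lbrakk>x \<in> X; y \<in> X\<rbrakk> \<Longrightarrow> d x y = 0 \<longleftrightarrow> x = y"
    and d_triangle: "\<lbrakk>x \<in> X; y \<in> X; z \<in> X\<rbrakk> \<Longrightarrow> d x z \<le> d x y + d y z"
    and d_step: "\<lbrakk>x \<in> X; y \<in> X; d x y = Suc k\<rbrakk> \<Longrightarrow> \<exists>z\<in>X. d x z = 1 \<and> d z y = k"
begin

text \<open>Membership of the matrix \<open>F\<close> in the span \<open>V\<close>; \<open>t\<close>
  lists the coefficients.\<close>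

definition determined :: "('a \<Rightarrow> 'a \<Rightarrow> nat) \<Rightarrow> bool" where
  "determined F \<longleftrightarrow> (\<exists>t. \<forall>x\<in>X. \<forall>y\<in>X. F x y = t (d x y))"

lemma determinedI:
  assumes "\<And>x y x' y'. \<lbrakk>x \<in> X; y \<in> X; x' \<in> X; y' \<in> X; d x y = d x' y'\<rbrakk> \<Longrightarrow> F x y = F x' y'"
  shows "determined F"
proof -
  define t where "t h = (SOME n. \<exists>x\<in>X. \<exists>y\<in>X. d x y = h \<and> n = F x y)" for h
  have "F x y = t (d x y)" if xy: "x \<in> X" "y \<in> X" for x y
  proof -
    have "\<exists>u\<in>X. \<exists>v\<in>X. d u v = d x y \<and> t (d x y) = F u v"
      unfolding t_def by (rule someI_ex) (use xy in blast)
    then show ?thesis using assms xy by metis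
  qed
  then show ?thesis unfolding determined_def by blast
qed

lemma determinedD:
  assumes "determined F" "x \<in> X" "y \<in> X" "x' \<in> X" "y' \<in> X" "d x y = d x' y'"
  shows "F x y = F x' y'"
  using assms unfolding determined_def by metis

text \<open>The \<open>(x,y)\<close> entry of \<open>A\<^sub>j A\<^sub>k\<^sup>T\<close>.\<close>

definition meet :: "nat \<Rightarrow> nat \<Rightarrow> 'a \<Rightarrow> 'a \<Rightarrow> nat" where
  "meet j k x y = card {z \<in> X. d x z = j \<and> d y z = k}"

lemma meet_commute: "meet j k x y = meet k j y x"
  unfolding meet_def by (simp add: conj_commute)

text \<open>The finite index set of the nonzero distance matrices, over which linear combinations
  are summed.\<close>

definition dists :: "nat set" where
  "dists = (\<lambda>(x, y). d x y) ` (X \<times> X)"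

lemma finite_dists: "finite dists"
  unfolding dists_def using finite_X by simp

lemma d_in_dists: "\<lbrakk>x \<in> X; y \<in> X\<rbrakk> \<Longrightarrow> d x y \<in> dists"
  unfolding dists_def by auto

text \<open>Grouping the \<open>w\<close> by their distance from \<open>x\<close> expands an entry
  of \<open>T A\<^sub>k\<^sup>T\<close>, where \<open>T\<close> in \<open>V\<close> has the
  coefficients \<open>t\<close>.\<close>

lemma sum_sphere_eq:
  assumes "x \<in> X"
  shows "(\<Sum>w | w \<in> X \<and> d y w = k. t (d x w)) = (\<Sum>i\<in>dists. meet i k x y * t i)"
proof -
  let ?S = "{w. w \<in> X \<and> d y w = k}"
  have "(\<Sum>w\<in>?S. t (d x w)) = (\<Sum>i\<in>dists. \<Sum>w | w \<in> ?S \<and> d x w = i. t (d x w))"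
    using finite_X finite_dists assms by (subst sum.group) (auto intro: d_in_dists)
  also have "\<dots> = (\<Sum>i\<in>dists. meet i k x y * t i)"
  proof (rule sum.cong[OF refl])
    fix i
    have "{w \<in> X. d x w = i \<and> d y w = k} = {w. w \<in> ?S \<and> d x w = i}" by auto
    then show "(\<Sum>w | w \<in> ?S \<and> d x w = i. t (d x w)) = meet i k x y * t i"
      by (simp add: meet_def)
  qed
  finally show ?thesis .
qed

text \<open>\<open>A\<^sub>0\<close> is the identity, so the product is \<open>A\<^sub>j\<close>
  itself.\<close>

lemma determined_meet_0: "determined (meet j 0)"
proof (rule determinedI)
  have "meet j 0 x y = (if d x y = j then 1 else 0)" if "x \<in> X" "y \<in> X" for x y
  proof -
    have "{z \<in> X. d x z = j \<and> d y z = 0} = (if d x y = j then {y} else {})"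
      using that d_eq_0_iff by auto
    then show ?thesis by (simp add: meet_def)
  qed
  then show "meet j 0 x y = meet j 0 x' y'"
    if "x \<in> X" "y \<in> X" "x' \<in> X" "y' \<in> X" "d x y = d x' y'" for x y x' y'
    using that by simp
qed

lemma d_le_Suc_iff:
  assumes "x \<in> X" "y \<in> X"
  shows "d y x \<le> Suc k \<longleftrightarrow> x = y \<or> (\<exists>z\<in>X. d y z = 1 \<and> d z x \<le> k)"
proof
  assume le: "d y x \<le> Suc k"
  show "x = y \<or> (\<exists>z\<in>X. d y z = 1 \<and> d z x \<le> k)"
  proof (cases "d y x")
    case 0
    then show ?thesis using assms d_eq_0_iff by auto
  next
    case (Suc n)
    then show ?thesis using d_step[OF assms(2,1) Suc] le by auto
  qed
next
  assume "x = y \<or> (\<exists>z\<in>X. d y z = 1 \<and> d z x \<le> k)"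
  then show "d y x \<le> Suc k"
    using assms d_eq_0_iff[of y x] d_triangle[of y _ x] by fastforce
qed

end

section \<open>Closure of \<open>V\<close> under transposition and multiplication\<close>

locale semiregular_digraph_metric = digraph_metric +
  assumes determined_meet_1: "determined (meet i 1)"
begin

text \<open>A return from \<open>y\<close> within \<open>Suc k\<close> steps passes, unless
  \<open>x = y\<close>, through an out-neighbour \<open>z\<close> of \<open>y\<close> with a return
  within \<open>k\<close> steps. By induction the latter depends only on \<open>d x z\<close>, and
  \<open>meet (d x z) 1\<close> decides whether an out-neighbour at that distance from
  \<open>x\<close> exists.\<close>

lemma reverse_le_determined:
  assumes "x \<in> X" "y \<in> X" "x' \<in> X" "y' \<in> X" "d x y = d x' y'"
  shows "d y x \<le> k \<longleftrightarrow> d y' x' \<le> k"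
  using assms
proof (induction k arbitrary: x y x' y')
  case 0
  then show ?case using d_eq_0_iff by (metis le_zero_eq)
next
  case (Suc k)
  have *: "\<exists>z'\<in>X. d v' z' = 1 \<and> d z' u' \<le> k"
    if uv: "u \<in> X" "v \<in> X" "u' \<in> X" "v' \<in> X" "d u v = d u' v'"
      and z: "z \<in> X" "d v z = 1" "d z u \<le> k" for u v u' v' z
  proof -
    have "z \<in> {w \<in> X. d u w = d u z \<and> d v w = 1}" using z by simp
    then have "meet (d u z) 1 u v \<noteq> 0"
      unfolding meet_def using finite_X by (auto simp: card_eq_0_iff)
    then have "meet (d u z) 1 u' v' \<noteq> 0"
      using determinedD[OF determined_meet_1 uv] by simp
    then obtain z' where "z' \<in> X" "d u' z' = d u z" "d v' z' = 1"
      unfolding meet_def by (auto dest!: card_ge_0_finite simp: card_eq_0_iff)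
    then show ?thesis using Suc.IH[of u z u' z'] uv z by auto
  qed
  have "x = y \<longleftrightarrow> x' = y'" using Suc.prems d_eq_0_iff by metis
  moreover have "(\<exists>z\<in>X. d y z = 1 \<and> d z x \<le> k) \<longleftrightarrow> (\<exists>z\<in>X. d y' z = 1 \<and> d z x' \<le> k)"
    using *[of x y x' y'] *[of x' y' x y] Suc.prems by metis
  ultimately show ?case using Suc.prems by (simp add: d_le_Suc_iff)
qed

lemma reverse_determined:
  assumes "x \<in> X" "y \<in> X" "x' \<in> X" "y' \<in> X" "d x y = d x' y'"
  shows "d y x = d y' x'"
  using reverse_le_determined[OF assms] by (meson le_antisym order_refl)

text \<open>In matrix terms, \<open>A\<^sub>k\<^sup>T = A\<^sub>m\<close>: the distance in one
  direction determines the other, in both directions.\<close>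

lemma ex_reverse_distance:
  obtains m where "\<And>u v. \<lbrakk>u \<in> X; v \<in> X\<rbrakk> \<Longrightarrow> d u v = k \<longleftrightarrow> d v u = m"
proof (cases "k \<in> dists")
  case True
  then obtain a b where ab: "a \<in> X" "b \<in> X" "d a b = k"
    unfolding dists_def by auto
  have "d u v = k \<longleftrightarrow> d v u = d b a" if "u \<in> X" "v \<in> X" for u v
    using reverse_determined[of u v a b] reverse_determined[of v u b a] ab that by auto
  then show ?thesis using that by blast
next
  case False
  \<comment> \<open>If \<open>k\<close> is not attained, any unattained \<open>m\<close> makes both
    sides false.\<close>
  obtain m where "m \<notin> dists"
    using finite_dists ex_new_if_finite infinite_UNIV_nat by blast
  then show ?thesis using False that d_in_dists by metis
qed

text \<open>The matrix is \<open>A\<^sub>1 A\<^sub>k\<close>, the transpose of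
  \<open>A\<^sub>m A\<^sub>1\<^sup>T\<close> with
  \<open>A\<^sub>m = A\<^sub>k\<^sup>T\<close>.\<close>

lemma determined_step_count: "determined (\<lambda>y z. card {w \<in> X. d y w = 1 \<and> d w z = k})"
proof (rule determinedI)
  obtain m where m: "\<And>u v. \<lbrakk>u \<in> X; v \<in> X\<rbrakk> \<Longrightarrow> d u v = k \<longleftrightarrow> d v u = m"
    using ex_reverse_distance by blast
  have eq: "card {w \<in> X. d y w = 1 \<and> d w z = k} = meet m 1 z y" if "z \<in> X" for y z
    unfolding meet_def by (rule arg_cong[of _ _ card]) (use m that in auto)
  show "card {w \<in> X. d y w = 1 \<and> d w z = k} = card {w \<in> X. d y' w = 1 \<and> d w z' = k}"
    if "y \<in> X" "z \<in> X" "y' \<in> X" "z' \<in> X" "d y z = d y' z'" for y z y' z'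
    unfolding eq[OF that(2)] eq[OF that(4)]
    by (rule determinedD[OF determined_meet_1 that(2,1,4,3) reverse_determined[OF that]])
qed

text \<open>
  Both sides of the count below are the \<open>(x,y)\<close> entry of \<open>A\<^sub>j A\<^sub>n\<^sup>T A\<^sub>1\<^sup>T\<close>, bracketed in the two
  possible ways.
\<close>

lemma determined_meet: "determined (meet j k)"
proof (induction k rule: less_induct)
  case (less k)
  show ?case
  proof (cases k)
    case 0
    then show ?thesis using determined_meet_0 by simp
  next
    case (Suc n)
    obtain t where t: "\<And>x y. \<lbrakk>x \<in> X; y \<in> X\<rbrakk> \<Longrightarrow> meet j n x y = t (d x y)"
      using less[of n] Suc unfolding determined_def by auto
    \<comment> \<open>These are the coefficients of \<open>A\<^sub>1 A\<^sub>n\<close>, hence of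
      \<open>A\<^sub>n\<^sup>T A\<^sub>1\<^sup>T\<close> in terms of the transposed distance
      matrices.\<close>
    obtain c where c: "\<And>y z. \<lbrakk>y \<in> X; z \<in> X\<rbrakk> \<Longrightarrow> card {w \<in> X. d y w = 1 \<and> d w z = n} = c (d y z)"
      using determined_step_count[of n] unfolding determined_def by blast
    have c_zero: "c h = 0" if "h \<in> dists" "h > k" for h
    proof -
      obtain y z where yz: "y \<in> X" "z \<in> X" "d y z = h"
        using \<open>h \<in> dists\<close> unfolding dists_def by auto
      have "{w \<in> X. d y w = 1 \<and> d w z = n} = {}"
        using d_triangle[of y _ z] yz that Suc by fastforce
      then show ?thesis using c[OF yz(1,2)] yz(3) by (metis card.empty)
    qed
    have count: "(\<Sum>h\<in>dists. meet j h x y * c h) = (\<Sum>i\<in>dists. meet i 1 x y * t i)"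
      if xy: "x \<in> X" "y \<in> X" for x y
    proof -
      have "(\<Sum>h\<in>dists. meet j h x y * c h) = (\<Sum>z | z \<in> X \<and> d x z = j. c (d y z))"
        using xy by (simp add: sum_sphere_eq meet_commute[of j])
      also have "\<dots> = (\<Sum>z | z \<in> X \<and> d x z = j. card {w \<in> {w. w \<in> X \<and> d y w = 1}. d w z = n})"
        using xy by (intro sum.cong) (auto simp flip: c)
      \<comment> \<open>Double counting of the pairs \<open>(z,w)\<close> with
        \<open>d w z = n\<close>.\<close>
      also have "\<dots> = (\<Sum>w | w \<in> X \<and> d y w = 1. card {z \<in> {z. z \<in> X \<and> d x z = j}. d w z = n})"
        using finite_X by (intro sum_multicount_gen) auto
      also have "\<dots> = (\<Sum>w | w \<in> X \<and> d y w = 1. t (d x w))"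
        using xy by (intro sum.cong) (auto simp: meet_def simp flip: t)
      also have "\<dots> = (\<Sum>i\<in>dists. meet i 1 x y * t i)"
        using xy by (simp add: sum_sphere_eq)
      finally show ?thesis .
    qed
    show ?thesis
    proof (rule determinedI)
      fix x y x' y'
      assume xy: "x \<in> X" "y \<in> X" "x' \<in> X" "y' \<in> X" "d x y = d x' y'"
      show "meet j k x y = meet j k x' y'"
      proof (cases "k \<in> dists")
        case True
        then obtain u v where uv: "u \<in> X" "v \<in> X" "d u v = k"
          unfolding dists_def by auto
        \<comment> \<open>The first step of a shortest walk from \<open>u\<close> to
          \<open>v\<close> makes the coefficient at \<open>k\<close> positive.\<close>
        then have "{w \<in> X. d u w = 1 \<and> d w v = n} \<noteq> {}"
          using d_step[of u v n] Suc by auto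
        then have "card {w \<in> X. d u w = 1 \<and> d w v = n} \<noteq> 0"
          using finite_X by (subst card_0_eq) auto
        then have "c k \<noteq> 0"
          unfolding c[OF uv(1,2)] uv(3) .
        have "(\<Sum>h\<in>dists. meet j h x y * c h) = (\<Sum>h\<in>dists. meet j h x' y' * c h)"
          using determinedD[OF determined_meet_1 xy] xy by (simp add: count)
        \<comment> \<open>Terms with \<open>h < k\<close> agree by induction and those with
          \<open>h > k\<close> vanish, so the term at \<open>k\<close> can be isolated and
          \<open>c k\<close> cancelled.\<close>
        moreover have "(\<Sum>h\<in>dists - {k}. meet j h x y * c h) = (\<Sum>h\<in>dists - {k}. meet j h x' y' * c h)"
        proof (rule sum.cong[OF refl])
          fix h assume "h \<in> dists - {k}"
          then consider "h < k" | "c h = 0" using c_zero by (auto simp: nat_neq_iff)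
          then show "meet j h x y * c h = meet j h x' y' * c h"
            by cases (simp_all add: determinedD[OF less xy])
        qed
        ultimately have "meet j k x y * c k = meet j k x' y' * c k"
          using finite_dists True by (simp add: sum.remove)
        with \<open>c k \<noteq> 0\<close> show ?thesis by simp
      next
        case False
        then have "meet j k u v = 0" if "v \<in> X" for u v
          unfolding meet_def using d_in_dists that by (auto simp: card_eq_0_iff)
        then show ?thesis using xy by simp
      qed
    qed
  qed
qed

text \<open>The matrix is \<open>A\<^sub>j A\<^sub>1\<close>, and
  \<open>A\<^sub>1 = A\<^sub>m\<^sup>T\<close> for a suitable \<open>m\<close>.\<close>

lemma determined_in_neighbours: "determined (\<lambda>x y. card {z \<in> X. d x z = j \<and> d z y = 1})"
proof (rule determinedI)
  obtain m where m: "\<And>u v. \<lbrakk>u \<in> X; v \<in> X\<rbrakk> \<Longrightarrow> d u v = 1 \<longleftrightarrow> d v u = m"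
    using ex_reverse_distance by blast
  have eq: "card {z \<in> X. d x z = j \<and> d z y = 1} = meet j m x y" if "y \<in> X" for x y
    unfolding meet_def by (rule arg_cong[of _ _ card]) (use m that in auto)
  show "card {z \<in> X. d x z = j \<and> d z y = 1} = card {z \<in> X. d x' z = j \<and> d z y' = 1}"
    if "x \<in> X" "y \<in> X" "x' \<in> X" "y' \<in> X" "d x y = d x' y'" for x y x' y'
    unfolding eq[OF that(2)] eq[OF that(4)] by (rule determinedD[OF determined_meet that])
qed

end

section \<open>From walks in a digraph to the abstract metric\<close>

context fin_digraph
begin

lemma awalk_cost_1: "awalk_cost (\<lambda>_. 1) p = real (length p)"
  by (induction p) auto

lemma ddist_le_length: "awalk u p v \<Longrightarrow> ddist G u v \<le> ereal (real (length p))"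
  using min_cost_le_walk_cost[of u p v "\<lambda>_. 1"] by (simp add: ddist_def awalk_cost_1)

lemma ex_shortest_awalk:
  assumes "u \<rightarrow>\<^sup>* v"
  obtains p where "awalk u p v" "ddist G u v = ereal (real (length p))"
  using min_cost_awalk[OF assms, of "\<lambda>_. 1"]
  by (auto simp: ddist_def awalk_cost_1 intro: awalkI_apath)

lemma ex_digraph_metric:
  assumes "strongly_connected G"
  obtains d where "digraph_metric (verts G) d"
    and "\<And>u v. \<lbrakk>u \<in> verts G; v \<in> verts G\<rbrakk> \<Longrightarrow> ddist G u v = ereal (real (d u v))"
proof -
  \<comment> \<open>The conversion loses nothing on vertices: by strong connectivity the distance is
    the length of some walk.\<close>
  define d where "d u v = nat \<lfloor>real_of_ereal (ddist G u v)\<rfloor>" for u v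
  have d: "\<exists>p. awalk u p v \<and> length p = d u v \<and> ddist G u v = ereal (real (d u v))"
    if uv: "u \<in> verts G" "v \<in> verts G" for u v
  proof -
    have "u \<rightarrow>\<^sup>* v" using assms uv by auto
    then obtain p where "awalk u p v" "ddist G u v = ereal (real (length p))"
      by (rule ex_shortest_awalk)
    then show ?thesis by (auto simp: d_def)
  qed
  have le: "d u v \<le> length p" if "awalk u p v" for u p v
  proof -
    from that have "u \<in> verts G" "v \<in> verts G" by auto
    then show ?thesis using ddist_le_length[OF that] d[of u v] by auto
  qed
  have "digraph_metric (verts G) d"
  proof
    show "finite (verts G)" by simp
    show "d x y = 0 \<longleftrightarrow> x = y" if "x \<in> verts G" "y \<in> verts G" for x y
    proof
      assume "d x y = 0"
      then show "x = y" using d[OF that] by (auto simp: awalk_Nil_iff)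
    next
      assume "x = y"
      then show "d x y = 0" using le[of x "[]" y] that by (auto simp: awalk_Nil_iff)
    qed
    show triangle: "d x z \<le> d x y + d y z"
      if "x \<in> verts G" "y \<in> verts G" "z \<in> verts G" for x y z
      using d[OF that(1,2)] d[OF that(2,3)] le awalk_appendI by (metis length_append)
    show "\<exists>z\<in>verts G. d x z = 1 \<and> d z y = k"
      if xy: "x \<in> verts G" "y \<in> verts G" and k: "d x y = Suc k" for x y k
    proof -
      obtain p where p: "awalk x p y" "length p = Suc k" using d[OF xy] k by auto
      then obtain e q where "p = e # q" by (cases p) auto
      then have e: "awalk x [e] (head G e)" and q: "awalk (head G e) q y" "length q = k"
        using p by (auto simp: awalk_Cons_iff awalk_Nil_iff)
      then have z: "head G e \<in> verts G" by auto
      \<comment> \<open>Splitting off the first arc bounds the two distances by \<open>1\<close> and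
        \<open>k\<close>; as they sum to at least \<open>Suc k\<close>, both bounds are
        equalities.\<close>
      show ?thesis
        using le[OF e] le[OF q(1)] q(2) triangle[OF xy(1) z xy(2)] k z
        by (intro bexI[of _ "head G e"]) auto
    qed
  qed
  then show ?thesis using that d by blast
qed

end

theorem theorem10p1:
  fixes G :: "('a, 'b) pre_digraph" and D :: nat
  assumes "digraph G"
    and "strongly_connected G"
    and "diam G = ereal (real D)"
  shows "distance_regular_digraph G \<longleftrightarrow>
    (\<forall>h \<le> D. \<forall>i \<le> D.
      \<forall>x \<in> verts G. \<forall>y \<in> out_sphere G h x.
      \<forall>x' \<in> verts G. \<forall>y' \<in> out_sphere G h x'.
        card (out_sphere G i x \<inter> out_sphere G 1 y) =
        card (out_sphere G i x' \<inter> out_sphere G 1 y'))"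
    (is "_ \<longleftrightarrow> ?R")
proof
  assume "distance_regular_digraph G"
  then obtain d_out where "\<And>i j x y. \<lbrakk>i \<le> D; j \<le> D; x \<in> verts G; y \<in> out_sphere G i x\<rbrakk> \<Longrightarrow>
      int (card (out_sphere G 1 y \<inter> out_sphere G j x)) = d_out i j"
    unfolding distance_regular_digraph_def assms(3) by auto
  \<comment> \<open>The common value is \<open>d_out h i\<close>.\<close>
  then show ?R by (metis Int_commute of_nat_eq_iff)
next
  assume R: ?R
  interpret digraph G by fact
  obtain d where "digraph_metric (verts G) d"
    and d: "\<And>u v. \<lbrakk>u \<in> verts G; v \<in> verts G\<rbrakk> \<Longrightarrow> ddist G u v = ereal (real (d u v))"
    using ex_digraph_metric[OF assms(2)] by blast
  interpret M: digraph_metric "verts G" d by fact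
  have out: "out_sphere G i x = {z \<in> verts G. d x z = i}" if "x \<in> verts G" for i x
    using that d by (auto simp: out_sphere_def)
  have "in": "in_sphere G i x = {z \<in> verts G. d z x = i}" if "x \<in> verts G" for i x
    using that d by (auto simp: in_sphere_def)
  have d_le: "d x y \<le> D" if "x \<in> verts G" "y \<in> verts G" for x y
  proof -
    have "ddist G x y \<le> diam G"
      unfolding diam_def using that by (meson SUP_upper SUP_upper2)
    then show ?thesis using assms(3) d that by simp
  qed
  have meet: "card (out_sphere G 1 y \<inter> out_sphere G i x) = M.meet i 1 x y"
    if "x \<in> verts G" "y \<in> verts G" for i x y
    unfolding M.meet_def using that by (intro arg_cong[of _ _ card]) (auto simp: out)
  have meet_in: "card (in_sphere G 1 y \<inter> out_sphere G i x) = card {z \<in> verts G. d x z = i \<and> d z y = 1}"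
    if "x \<in> verts G" "y \<in> verts G" for i x y
    using that by (intro arg_cong[of _ _ card]) (auto simp: out "in")
  have det: "M.determined (M.meet i 1)" for i
  proof (rule M.determinedI)
    fix x y x' y'
    assume xy: "x \<in> verts G" "y \<in> verts G" "x' \<in> verts G" "y' \<in> verts G" "d x y = d x' y'"
    show "M.meet i 1 x y = M.meet i 1 x' y'"
    proof (cases "i \<le> D")
      case True
      have "y \<in> out_sphere G (d x y) x" "y' \<in> out_sphere G (d x y) x'"
        using xy by (auto simp: out)
      then have "card (out_sphere G i x \<inter> out_sphere G 1 y) = card (out_sphere G i x' \<inter> out_sphere G 1 y')"
        using R True d_le[OF xy(1,2)] xy by blast
      then show ?thesis using meet xy by (simp add: Int_commute)
    next
      \<comment> \<open>The hypothesis speaks only of \<open>i \<le> D\<close>; beyond the diameter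
        the spheres are empty and every count is 0.\<close>
      case False
      then have "M.meet i 1 u v = 0" if "u \<in> verts G" for u v
        unfolding M.meet_def using d_le that by (auto simp: card_eq_0_iff)
      then show ?thesis using xy by simp
    qed
  qed
  interpret semiregular_digraph_metric "verts G" d
    by unfold_locales (rule det)
  \<comment> \<open>Each \<open>j\<close> has its own coefficient function; choice collects them
    into one array, indexed by \<open>j\<close> first.\<close>
  have "\<forall>j. \<exists>t. \<forall>x\<in>verts G. \<forall>y\<in>verts G. M.meet j 1 x y = t (d x y)"
    using det unfolding M.determined_def by blast
  from choice[OF this] obtain t_out where t_out:
      "\<And>j x y. \<lbrakk>x \<in> verts G; y \<in> verts G\<rbrakk> \<Longrightarrow> M.meet j 1 x y = t_out j (d x y)"
    by blast
  have "\<forall>j. \<exists>t. \<forall>x\<in>verts G. \<forall>y\<in>verts G.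
      card {z \<in> verts G. d x z = j \<and> d z y = 1} = t (d x y)"
    using determined_in_neighbours unfolding M.determined_def by blast
  from choice[OF this] obtain t_in where t_in: "\<And>j x y. \<lbrakk>x \<in> verts G; y \<in> verts G\<rbrakk> \<Longrightarrow>
      card {z \<in> verts G. d x z = j \<and> d z y = 1} = t_in j (d x y)"
    by blast
  show "distance_regular_digraph G"
    unfolding distance_regular_digraph_def
  proof (intro exI allI impI ballI)
    fix i j x y
    assume x: "x \<in> verts G" and "y \<in> out_sphere G i x"
    then have y: "y \<in> verts G" "d x y = i" by (auto simp: out)
    show "int (card (out_sphere G 1 y \<inter> out_sphere G j x)) = (\<lambda>i j. int (t_out j i)) i j \<and>
        int (card (in_sphere G 1 y \<inter> out_sphere G j x)) = (\<lambda>i j. int (t_in j i)) i j"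
      using meet[OF x y(1)] meet_in[OF x y(1)] t_out[OF x y(1)] t_in[OF x y(1)] y(2) by simp
  qed
qed

end
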